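(* Let $\varphi$ be a Ma-Minda function with $\varphi(z)=1+B_1z+B_2z^2+B_3z^3+\cdots$, and let $f\in\mathcal{C}(\varphi)$. Put $$\sigma_2=-\frac{5B_1^2-4B_2}{2B_1},\qquad \mu_2=\frac{3B_1^3-5B_1B_2+2B_3}{2B_1}.$$ If $|B_2-\frac54B_1^2|\ge B_1$ and $(\sigma_2,\mu_2)\in\Omega_2\cup\Omega_3$, then $$|T_{2,2}(F_{f^{-1}})|=|\Gamma_2^2-\Gamma_3^2|\le\frac{1}{144}\Big(B_2-\frac54B_1^2\Big)^2+\frac{(3B_1^3-5B_1B_2+2B_3)^2}{2304}.$$ The estimate is sharp (for each such $\varphi$, equality is attained by some $f\in\mathcal{C}(\varphi)$).
   Context: $\mathbb{U}=\{z\in\mathbb{C}:|z|<1\}$, and $\mathcal{A}$ is the class of analytic functions $f$ on $\mathbb{U}$ of the form $f(z)=z+\sum_{n\ge2}a_nz^n$. For analytic $g,h$ on $\mathbb{U}$, $g\prec h$ (subordination) means there is an analytic $\omega:\mathbb{U}\to\mathbb{C}$ with $\omega(0)=0$, $|\omega(z)|\le1$, and $g=h\circ\omega$. A Ma-Minda function is an analytic univalent $\varphi$ on $\mathbb{U}$ with $\varphi(0)=1$, $\varphi'(0)>0$, mapping $\mathbb{U}$ onto a domain in the right half-plane that is symmetric about the real axis and starlike with respect to $\varphi(0)=1$ (so $B_1>0$ and all $B_n$ are real). $\mathcal{C}(\varphi)=\{f\in\mathcal{A}: 1+zf''(z)/f'(z)\prec\varphi(z)\}$; its members are univalent. The local inverse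 $f^{-1}$ near $0$ has the logarithmic coefficients $\Gamma_n$ defined by $F_{f^{-1}}(w)=\log\big(f^{-1}(w)/w\big)=2\sum_{n\ge1}\Gamma_nw^n$ (with $\log 1=0$). Equivalently $\Gamma_2=-\tfrac12(a_3-\tfrac32a_2^2)$, $\Gamma_3=-\tfrac12(a_4-4a_2a_3+\tfrac{10}{3}a_2^3)$. Definition: $T_{2,2}(F_{f^{-1}})=\Gamma_2^2-\Gamma_3^2$. Regions in $\mathbb{R}^2$: $\Omega_2=\{(\sigma,\mu):2\le|\sigma|\le4,\ \mu\ge\frac1{12}(\sigma^2+8)\}$, $\Omega_3=\{(\sigma,\mu):|\sigma|\ge4,\ \mu\ge\frac23(|\sigma|-1)\}$. *)

theory Defs
  imports "HOL-Complex_Analysis.Complex_Analysis"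
begin

abbreviation unit_disc :: "complex set" where
  "unit_disc \<equiv> ball 0 1"

definition class_A :: "(complex \<Rightarrow> complex) set" where
  "class_A = {f. f holomorphic_on unit_disc \<and> f 0 = 0 \<and> deriv f 0 = 1}"

(* By the maximum principle the conditions on \<omega> force it to map the disc into itself,
   so h is only evaluated inside the disc. *)
definition subordinate :: "(complex \<Rightarrow> complex) \<Rightarrow> (complex \<Rightarrow> complex) \<Rightarrow> bool" where
  "subordinate g h \<longleftrightarrow>
     g holomorphic_on unit_disc \<and> h holomorphic_on unit_disc \<and>
     (\<exists>\<omega>. \<omega> holomorphic_on unit_disc \<and> \<omega> 0 = 0 \<and>
          (\<forall>z\<in>unit_disc. norm (\<omega> z) \<le> 1) \<and> (\<forall>z\<in>unit_disc. g z = h (\<omega> z)))"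

(* The image is automatically a domain (open and connected). *)
definition ma_minda :: "(complex \<Rightarrow> complex) \<Rightarrow> bool" where
  "ma_minda \<phi> \<longleftrightarrow>
     \<phi> holomorphic_on unit_disc \<and> inj_on \<phi> unit_disc \<and> \<phi> 0 = 1 \<and>
     deriv \<phi> 0 \<in> \<real> \<and> Re (deriv \<phi> 0) > 0 \<and>
     \<phi> ` unit_disc \<subseteq> {w. Re w > 0} \<and>
     cnj ` \<phi> ` unit_disc = \<phi> ` unit_disc \<and>
     (\<forall>w \<in> \<phi> ` unit_disc. closed_segment 1 w \<subseteq> \<phi> ` unit_disc)"

(* Taking real parts loses nothing: the Taylor coefficients of a Ma-Minda function are real,
   see ma_minda_sums below. *)
definition mm_coeff :: "(complex \<Rightarrow> complex) \<Rightarrow> nat \<Rightarrow> real" where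
  "mm_coeff \<phi> n = Re ((deriv ^^ n) \<phi> 0 / fact n)"

(* The condition on the derivative is implicit in writing the quotient f''/f'; it is spelled out
   because division by zero is total here. *)
definition class_C :: "(complex \<Rightarrow> complex) \<Rightarrow> (complex \<Rightarrow> complex) set" where
  "class_C \<phi> = {f \<in> class_A. (\<forall>z\<in>unit_disc. deriv f z \<noteq> 0) \<and>
     subordinate (\<lambda>z. 1 + z * deriv (deriv f) z / deriv f z) \<phi>}"

definition is_local_inverse :: "(complex \<Rightarrow> complex) \<Rightarrow> (complex \<Rightarrow> complex) \<Rightarrow> bool" where
  "is_local_inverse f g \<longleftrightarrow>
     (\<exists>r>0. g holomorphic_on ball 0 r \<and> g 0 = 0 \<and>
        (\<forall>w\<in>ball 0 r. g w \<in> unit_disc \<and> f (g w) = w))"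

(* Only the germ at 0 of the chosen function matters, and this germ is unique:
   see local_inverse_exists and local_inverse_unique. *)
definition local_inverse :: "(complex \<Rightarrow> complex) \<Rightarrow> complex \<Rightarrow> complex" where
  "local_inverse f = (SOME g. is_local_inverse f g)"

(* The value at 0 is that of the removable singularity, g(w)/w tending to 1. *)
definition F_inv :: "(complex \<Rightarrow> complex) \<Rightarrow> complex \<Rightarrow> complex" where
  "F_inv f w = (if w = 0 then 0 else Ln (local_inverse f w / w))"

(* Half the n-th Taylor coefficient of F_inv f at 0; see inv_log_coeff_sums. *)
definition inv_log_coeff :: "(complex \<Rightarrow> complex) \<Rightarrow> nat \<Rightarrow> complex" where
  "inv_log_coeff f n = (deriv ^^ n) (F_inv f) 0 / (2 * fact n)"

definition T22_inv :: "(complex \<Rightarrow> complex) \<Rightarrow> complex" where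
  "T22_inv f = (inv_log_coeff f 2)\<^sup>2 - (inv_log_coeff f 3)\<^sup>2"

definition Omega2 :: "(real \<times> real) set" where
  "Omega2 = {(\<sigma>, \<mu>). 2 \<le> \<bar>\<sigma>\<bar> \<and> \<bar>\<sigma>\<bar> \<le> 4 \<and> \<mu> \<ge> (\<sigma>\<^sup>2 + 8) / 12}"

definition Omega3 :: "(real \<times> real) set" where
  "Omega3 = {(\<sigma>, \<mu>). \<bar>\<sigma>\<bar> \<ge> 4 \<and> \<mu> \<ge> 2 / 3 * (\<bar>\<sigma>\<bar> - 1)}"

lemma deriv_conj:
  assumes "h holomorphic_on unit_disc" "z \<in> unit_disc"
  shows "deriv (cnj \<circ> h \<circ> cnj) z = cnj (deriv h (cnj z))"
proof -
  have "(h has_field_derivative deriv h (cnj z)) (at (cnj z))"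
    using assms by (intro holomorphic_derivI[OF _ open_ball]) auto
  from has_field_derivative_cnj_cnj[OF this] show ?thesis
    by (intro DERIV_imp_deriv) simp
qed

lemma ma_minda_cnj:
  assumes "ma_minda \<phi>" "z \<in> unit_disc"
  shows "\<phi> (cnj z) = cnj (\<phi> z)"
proof -
  have hol: "\<phi> holomorphic_on unit_disc" and inj: "inj_on \<phi> unit_disc" and "\<phi> 0 = 1"
    and re: "deriv \<phi> 0 \<in> \<real>" and sym: "cnj ` \<phi> ` unit_disc = \<phi> ` unit_disc"
    using assms(1) by (auto simp: ma_minda_def)
  obtain g where g: "g holomorphic_on \<phi> ` unit_disc"
      "\<And>z. z \<in> unit_disc \<Longrightarrow> deriv \<phi> z * deriv g (\<phi> z) = 1"
      "\<And>z. z \<in> unit_disc \<Longrightarrow> g (\<phi> z) = z"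
    using holomorphic_has_inverse[OF hol open_ball inj] by metis
  define \<psi> where "\<psi> = cnj \<circ> \<phi> \<circ> cnj"
  have disc: "cnj ` unit_disc = unit_disc"
    by (auto simp: image_iff intro!: bexI[where x = "cnj _"])
  have hol\<psi>: "\<psi> holomorphic_on unit_disc"
    unfolding \<psi>_def by (rule holomorphic_on_compose_cnj_cnj) (use hol disc in auto)
  have im: "\<psi> ` unit_disc = \<phi> ` unit_disc"
    unfolding \<psi>_def image_comp[symmetric] using disc sym by simp
  have op: "open (\<phi> ` unit_disc)"
    using open_mapping_thm3[OF hol open_ball inj] .
  define \<omega> where "\<omega> = g \<circ> \<psi>"
  have hol\<omega>: "\<omega> holomorphic_on unit_disc"
    unfolding \<omega>_def by (rule holomorphic_on_compose_gen[OF hol\<psi> g(1)]) (use im in auto)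
  have \<omega>_in: "norm (\<omega> z) < 1" if "norm z < 1" for z
  proof -
    have "\<psi> z \<in> \<phi> ` unit_disc" using im that by auto
    then show ?thesis using g(3) by (auto simp: \<omega>_def)
  qed
  have \<psi>0: "\<psi> 0 = 1" by (simp add: \<psi>_def \<open>\<phi> 0 = 1\<close>)
  have \<omega>0: "\<omega> 0 = 0" using g(3)[of 0] by (simp add: \<omega>_def \<psi>0 \<open>\<phi> 0 = 1\<close>)
  have d\<psi>: "deriv \<psi> 0 = deriv \<phi> 0"
    using deriv_conj[OF hol, of 0] re by (simp add: \<psi>_def Reals_cnj_iff)
  have d\<omega>: "deriv \<omega> 0 = 1"
  proof -
    have "deriv \<omega> 0 = deriv g (\<psi> 0) * deriv \<psi> 0"
      unfolding \<omega>_def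
      by (rule deriv_chain)
         (use \<psi>0 \<open>\<phi> 0 = 1\<close> in \<open>auto intro!: holomorphic_on_imp_differentiable_at[OF hol\<psi>]
            holomorphic_on_imp_differentiable_at[OF g(1) op] image_eqI[of _ \<phi> 0]\<close>)
    then show ?thesis using g(2)[of 0] by (simp add: \<psi>0 d\<psi> \<open>\<phi> 0 = 1\<close> mult.commute)
  qed
  obtain \<alpha> where \<alpha>: "\<And>z. norm z < 1 \<Longrightarrow> \<omega> z = \<alpha> * z"
    using Schwarz_Lemma(3)[OF hol\<omega> \<omega>0 \<omega>_in, of 0] d\<omega> by auto
  have "deriv \<omega> 0 = deriv (\<lambda>z. \<alpha> * z) 0"
    by (rule deriv_cong_ev) (auto simp: eventually_nhds \<alpha> intro!: exI[of _ unit_disc])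
  then have "\<alpha> = 1" using d\<omega> by simp
  have *: "\<psi> z = \<phi> z"
  proof -
    have "\<psi> z \<in> \<phi> ` unit_disc" using im assms(2) by blast
    then have "\<phi> (g (\<psi> z)) = \<psi> z" using g(3) by auto
    then show ?thesis using \<alpha>[of z] \<open>\<alpha> = 1\<close> assms(2) by (simp add: \<omega>_def)
  qed
  then have "cnj (cnj (\<phi> (cnj z))) = cnj (\<phi> z)" by (simp add: \<psi>_def)
  then show ?thesis by simp
qed

lemma ma_minda_sums:
  assumes "ma_minda \<phi>" "z \<in> unit_disc"
  shows "(\<lambda>n. complex_of_real (mm_coeff \<phi> n) * z ^ n) sums \<phi> z"
proof -
  have hol: "\<phi> holomorphic_on unit_disc" using assms(1) by (simp add: ma_minda_def)
  have conj: "(deriv ^^ n) \<phi> (cnj z) = cnj ((deriv ^^ n) \<phi> z)" if "z \<in> unit_disc" for n z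
    using that
  proof (induction n arbitrary: z)
    case 0
    then show ?case using ma_minda_cnj[OF assms(1)] by simp
  next
    case (Suc n)
    let ?h = "(deriv ^^ n) \<phi>"
    have holh: "?h holomorphic_on unit_disc" by (rule holomorphic_higher_deriv[OF hol open_ball])
    have "deriv (cnj \<circ> ?h \<circ> cnj) z = deriv ?h z"
      by (rule deriv_cong_ev)
         (use Suc in \<open>auto simp: eventually_nhds intro!: exI[of _ unit_disc]\<close>)
    then show ?case using deriv_conj[OF holh Suc.prems] by (metis complex_cnj_cnj comp_apply funpow.simps(2))
  qed
  have "(deriv ^^ n) \<phi> 0 \<in> \<real>" for n
    using conj[of 0 n] by (simp add: Reals_cnj_iff)
  then have "complex_of_real (mm_coeff \<phi> n) = (deriv ^^ n) \<phi> 0 / fact n" for n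
    unfolding mm_coeff_def by (intro of_real_Re Reals_divide)
      (simp_all add: fact_in_Reals)
  then show ?thesis using holomorphic_power_series[OF hol assms(2)] by simp
qed

lemma local_inverse_exists:
  assumes "f \<in> class_A"
  shows "is_local_inverse f (local_inverse f)"
proof -
  have hol: "f holomorphic_on unit_disc" and f0: "f 0 = 0" and d: "deriv f 0 \<noteq> 0"
    using assms by (auto simp: class_A_def)
  obtain s where s: "s > 0" "ball 0 s \<subseteq> unit_disc" "inj_on f (ball 0 s)"
    using has_complex_derivative_locally_injective[OF hol _ open_ball d] by auto
  have hols: "f holomorphic_on ball 0 s" using hol s(2) holomorphic_on_subset by blast
  obtain g where g: "g holomorphic_on f ` ball 0 s" "\<And>z. z \<in> ball 0 s \<Longrightarrow> g (f z) = z"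
    using holomorphic_has_inverse[OF hols open_ball s(3)] by metis
  have "open (f ` ball 0 s)" "0 \<in> f ` ball 0 s"
    using open_mapping_thm3[OF hols open_ball s(3)] s(1) f0 by (auto intro!: image_eqI[of _ f 0])
  then obtain r where r: "r > 0" "ball 0 r \<subseteq> f ` ball 0 s"
    by (meson open_contains_ball)
  have "is_local_inverse f g"
    unfolding is_local_inverse_def
  proof (intro exI[of _ r] conjI ballI)
    show "g holomorphic_on ball 0 r" using g(1) r(2) holomorphic_on_subset by blast
    show "g 0 = 0" using g(2)[of 0] f0 s(1) by simp
    fix w assume "w \<in> ball (0::complex) r"
    then obtain z where "z \<in> ball 0 s" "w = f z" using r(2) by blast
    then show "g w \<in> unit_disc" "f (g w) = w" using g(2) s(2) by auto
  qed (rule r(1))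
  then show ?thesis unfolding local_inverse_def by (rule someI[of "is_local_inverse f"])
qed

lemma local_inverse_unique:
  assumes "f \<in> class_A" "is_local_inverse f g" "is_local_inverse f h"
  shows "eventually (\<lambda>w. g w = h w) (nhds 0)"
proof -
  have hol: "f holomorphic_on unit_disc" and d: "deriv f 0 \<noteq> 0"
    using assms(1) by (auto simp: class_A_def)
  obtain s where s: "s > 0" "inj_on f (ball 0 s)"
    using has_complex_derivative_locally_injective[OF hol _ open_ball d] by auto
  have *: "eventually (\<lambda>w. k w \<in> ball 0 s \<and> f (k w) = w) (nhds 0)"
    if k: "is_local_inverse f k" for k
  proof -
    obtain r where r: "r > 0" "k holomorphic_on ball 0 r" "k 0 = 0"
        "\<forall>w\<in>ball 0 r. f (k w) = w"
      using k by (auto simp: is_local_inverse_def)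
    have "isCont k 0"
      using r(1) holomorphic_on_imp_continuous_on[OF r(2)]
      by (auto simp: continuous_on_eq_continuous_at)
    then have "filterlim k (nhds 0) (nhds 0)"
      using r(3) tendsto_at_iff_tendsto_nhds[of k 0] by (simp add: isCont_def)
    then have "eventually (\<lambda>w. k w \<in> ball 0 s) (nhds 0)"
      using s(1) by (intro topological_tendstoD) auto
    moreover have "eventually (\<lambda>w. w \<in> ball 0 r) (nhds (0::complex))"
      using r(1) by (intro eventually_nhds_in_open) auto
    ultimately show ?thesis by eventually_elim (use r(4) in auto)
  qed
  show ?thesis
    using *[OF assms(2)] *[OF assms(3)]
    by eventually_elim (use s(2) in \<open>metis inj_onD\<close>)
qed

lemma inv_log_coeff_sums:
  assumes "f \<in> class_A"
  shows "eventually (\<lambda>w. (\<lambda>n. 2 * inv_log_coeff f n * w ^ n) sums F_inv f w) (nhds 0)"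
proof -
  define g where "g = local_inverse f"
  obtain r where r: "r > 0" "g holomorphic_on ball 0 r" "g 0 = 0"
      "\<And>w. w \<in> ball 0 r \<Longrightarrow> g w \<in> unit_disc \<and> f (g w) = w"
    using local_inverse_exists[OF assms] by (auto simp: is_local_inverse_def g_def)
  have hol: "f holomorphic_on unit_disc" and df: "deriv f 0 = 1"
    using assms by (auto simp: class_A_def)
  have "deriv (f \<circ> g) 0 = deriv f (g 0) * deriv g 0"
    by (rule deriv_chain)
       (use r(1,3) in \<open>auto intro!: holomorphic_on_imp_differentiable_at[OF hol]
          holomorphic_on_imp_differentiable_at[OF r(2)]\<close>)
  moreover have "deriv (f \<circ> g) 0 = deriv (\<lambda>w. w) 0"
    by (rule deriv_cong_ev)
       (use r(1,4) in \<open>auto simp: eventually_nhds intro!: exI[of _ "ball 0 r"]\<close>)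
  ultimately have dg: "deriv g 0 = 1" using df r(3) by simp
  define k where "k = (\<lambda>w. if w = 0 then 1 else g w / w)"
  have holk: "k holomorphic_on ball 0 r"
    using pole_theorem_open_0[OF r(2) open_ball, of 0 k] r(3) dg by (auto simp: k_def)
  then have "isCont k 0"
    using r(1) holomorphic_on_imp_continuous_on[OF holk]
    by (auto simp: continuous_on_eq_continuous_at)
  then have "eventually (\<lambda>w. k w \<in> ball 1 1) (nhds 0)"
    by (intro topological_tendstoD[of k 1])
       (use tendsto_at_iff_tendsto_nhds[of k 0] in \<open>auto simp: isCont_def k_def\<close>)
  then obtain s where s: "s > 0" "\<And>w. w \<in> ball 0 s \<Longrightarrow> k w \<in> ball 1 1"
    by (auto simp: eventually_nhds_metric dist_commute)
  have nonpos: "u \<notin> \<real>\<^sub>\<le>\<^sub>0" if "u \<in> ball 1 1" for u :: complex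
  proof
    assume "u \<in> \<real>\<^sub>\<le>\<^sub>0"
    then have "Re (1 - u) \<ge> 1" by (auto simp: complex_nonpos_Reals_iff)
    then show False using that complex_Re_le_cmod[of "1 - u"] by (simp add: dist_norm)
  qed
  have "(\<lambda>w. Ln (k w)) holomorphic_on ball 0 (min r s)"
    by (intro holomorphic_intros holomorphic_on_subset[OF holk]) (use s(2) nonpos in auto)
  moreover have "F_inv f = (\<lambda>w. Ln (k w))" by (auto simp: F_inv_def k_def g_def)
  ultimately have "F_inv f holomorphic_on ball 0 (min r s)" by simp
  from holomorphic_power_series[OF this]
  have "(\<lambda>n. 2 * inv_log_coeff f n * w ^ n) sums F_inv f w" if "w \<in> ball 0 (min r s)" for w
    using that by (simp add: inv_log_coeff_def)
  moreover have "eventually (\<lambda>w. w \<in> ball 0 (min r s)) (nhds (0::complex))"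
    using r(1) s(1) by (intro eventually_nhds_in_open) auto
  ultimately show ?thesis by (auto elim: eventually_mono)
qed

end

theory Submission
  imports Defs
begin

text \<open>
  Write \<open>\<omega>\<close> for the Schwarz function with \<open>1 + z f'' / f' = \<phi> \<circ> \<omega>\<close> and \<open>c\<^sub>n\<close> for its coefficients. Comparing power
  series gives \<open>\<Gamma>\<^sub>2 = - (B\<^sub>1 c\<^sub>2 + (B\<^sub>2 - 5/4 B\<^sub>1\<^sup>2) c\<^sub>1\<^sup>2) / 12\<close> and
  \<open>\<Gamma>\<^sub>3 = - B\<^sub>1 (c\<^sub>3 + \<sigma>\<^sub>2 c\<^sub>1 c\<^sub>2 + \<mu>\<^sub>2 c\<^sub>1\<^sup>3) / 24\<close>. Two steps of the Schur algorithm parametrise \<open>c\<^sub>1, c\<^sub>2, c\<^sub>3\<close>;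
  this bounds \<open>\<bar>\<Gamma>\<^sub>2\<bar>\<close> at once, and \<open>\<bar>\<Gamma>\<^sub>3\<bar>\<close> by the inequality
  \<open>\<bar>c\<^sub>3 + \<sigma> c\<^sub>1 c\<^sub>2 + \<mu> c\<^sub>1\<^sup>3\<bar> \<le> \<mu>\<close> of Prokhorov and Szynal. The function with \<open>\<omega> z = \<i> z\<close> attains both
  bounds, and makes \<open>\<Gamma>\<^sub>2\<^sup>2\<close> and \<open>- \<Gamma>\<^sub>3\<^sup>2\<close> nonnegative, so that they add up.
\<close>

section \<open>Coefficients of low order in products and composites of power series\<close>

unbundle no vec_syntax

lemma fps_mult_nth_low:
  fixes F G :: "'a::comm_ring_1 fps"
  shows "(F * G) $ 2 = F $ 0 * G $ 2 + F $ 1 * G $ 1 + F $ 2 * G $ 0"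
    and "(F * G) $ 3 = F $ 0 * G $ 3 + F $ 1 * G $ 2 + F $ 2 * G $ 1 + F $ 3 * G $ 0"
  by (simp_all add: fps_mult_nth eval_nat_numeral)

lemma fps_compose_nth_low:
  fixes F G :: "'a::comm_ring_1 fps"
  assumes "G $ 0 = 0"
  shows "(F oo G) $ 1 = F $ 1 * G $ 1"
    and "(F oo G) $ 2 = F $ 1 * G $ 2 + F $ 2 * (G $ 1)\<^sup>2"
    and "(F oo G) $ 3 = F $ 1 * G $ 3 + 2 * F $ 2 * G $ 1 * G $ 2 + F $ 3 * (G $ 1) ^ 3"
    and "(F oo G) $ 4 = F $ 1 * G $ 4 + F $ 2 * (2 * G $ 1 * G $ 3 + (G $ 2)\<^sup>2)
           + 3 * F $ 3 * (G $ 1)\<^sup>2 * G $ 2 + F $ 4 * (G $ 1) ^ 4"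
  using assms by (simp_all add: fps_compose_nth fps_mult_nth eval_nat_numeral algebra_simps)

lemma fps_expansion_eq_if_eventually_eq:
  fixes F G :: "complex fps"
  assumes "f has_fps_expansion F" "g has_fps_expansion G" "eventually (\<lambda>z. f z = g z) (nhds 0)"
  shows "F = G"
  using assms fps_expansion_unique_complex has_fps_expansion_cong by blast

section \<open>Schwarz functions and the Schur algorithm\<close>

lemma norm_less_1_of_norm_le_1:
  assumes hol: "\<psi> holomorphic_on unit_disc"
    and le: "\<forall>z\<in>unit_disc. norm (\<psi> z) \<le> 1"
    and "norm (\<psi> 0) < 1" "z \<in> unit_disc"
  shows "norm (\<psi> z) < 1"
proof (rule ccontr)
  assume "\<not> norm (\<psi> z) < 1"
  then have "norm (\<psi> z) = 1" using bspec[OF le assms(4)] by linarith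
  then have "\<psi> constant_on unit_disc"
    using maximum_modulus_principle[OF hol open_ball _ open_ball order_refl assms(4)] le by simp
  then have "\<psi> z = \<psi> 0" using assms(4) by (auto simp: constant_on_def)
  then show False using \<open>norm (\<psi> z) = 1\<close> assms(3) by simp
qed

text \<open>The bound at 0 is the bound on the derivative in the Schwarz lemma. It is weak because a
  rotation has a quotient of modulus 1; the Schur lemmas below therefore start from
  \<open>norm (\<psi> z) \<le> 1\<close>.\<close>

lemma Schwarz_quotient:
  assumes hol: "f holomorphic_on unit_disc" and "f 0 = 0"
    and less: "\<forall>z\<in>unit_disc. norm (f z) < 1"
  obtains h where "h holomorphic_on unit_disc" "\<forall>z\<in>unit_disc. norm (h z) \<le> 1"
    "\<And>z. z \<in> unit_disc \<Longrightarrow> f z = z * h z"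
proof -
  obtain h where h: "h holomorphic_on unit_disc" "\<And>z. norm z < 1 \<Longrightarrow> f z = z * h z" "deriv f 0 = h 0"
    using Schwarz3[OF hol \<open>f 0 = 0\<close>] by blast
  have "norm (h z) \<le> 1" if z: "z \<in> unit_disc" for z
  proof (cases "z = 0")
    case True
    then show ?thesis using Schwarz_Lemma(2)[OF hol \<open>f 0 = 0\<close>, of 0] less h(3) by simp
  next
    case False
    have "norm (f z) \<le> norm z"
      using Schwarz_Lemma(1)[OF hol \<open>f 0 = 0\<close>, of z] less z by simp
    then show ?thesis using h(2)[of z] z False by (simp add: norm_mult)
  qed
  then show ?thesis by (intro that[OF h(1)] ballI) (use h(2) in auto)
qed

text \<open>A Moebius map moves the value at 0 to 0, and the result is divided by \<open>z\<close>.
  The equation is multiplied out so that it also covers a value of modulus 1 at 0: then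
  \<open>\<psi>\<close> is constant by the maximum principle, the Moebius quotient would be 0/0, and
  \<open>\<kappa> = 0\<close> serves.\<close>

lemma Schur_step:
  assumes hol: "\<psi> holomorphic_on unit_disc"
    and le: "\<forall>z\<in>unit_disc. norm (\<psi> z) \<le> 1"
  obtains \<kappa> :: "complex \<Rightarrow> complex" where "\<kappa> holomorphic_on unit_disc"
    "\<forall>z\<in>unit_disc. norm (\<kappa> z) \<le> 1"
    "\<And>z. z \<in> unit_disc \<Longrightarrow> \<psi> z - \<psi> 0 = z * \<kappa> z * (1 - cnj (\<psi> 0) * \<psi> z)"
proof (cases "norm (\<psi> 0) < 1")
  case True
  define a where "a = \<psi> 0"
  have a: "norm a < 1" using True by (simp add: a_def)
  have less: "norm (\<psi> z) < 1" if "z \<in> unit_disc" for z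
    using norm_less_1_of_norm_le_1[OF hol le True that] .
  have nz: "1 - cnj a * \<psi> z \<noteq> 0" if "z \<in> unit_disc" for z
  proof
    assume "1 - cnj a * \<psi> z = 0"
    then have "norm (cnj a * \<psi> z) = 1" by simp
    moreover have "norm (cnj a * \<psi> z) < 1"
      using mult_strict_mono'[OF a less[OF that]] by (simp only: norm_mult complex_mod_cnj norm_ge_zero mult_1)
    ultimately show False by simp
  qed
  define f where "f z = (\<psi> z - a) / (1 - cnj a * \<psi> z)" for z
  have f: "f holomorphic_on unit_disc" "f 0 = 0"
    unfolding f_def by (intro holomorphic_intros hol) (use nz in \<open>auto simp: a_def\<close>)
  have "\<forall>z\<in>unit_disc. norm (f z) < 1"
    using Moebius_function_norm_lt_1[OF a less, of _ 0]
    by (simp add: Moebius_function_def f_def)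
  from Schwarz_quotient[OF f this]
  obtain h where h: "h holomorphic_on unit_disc" "\<forall>z\<in>unit_disc. norm (h z) \<le> 1"
    "\<And>z. z \<in> unit_disc \<Longrightarrow> f z = z * h z"
    by metis
  show ?thesis
  proof (rule that[OF h(1,2)])
    show "\<psi> z - \<psi> 0 = z * h z * (1 - cnj (\<psi> 0) * \<psi> z)" if "z \<in> unit_disc" for z
    proof -
      have "\<psi> z - a = f z * (1 - cnj a * \<psi> z)" using nz[OF that] by (simp add: f_def)
      then show ?thesis unfolding h(3)[OF that] a_def .
    qed
  qed
next
  case False
  then have "norm (\<psi> 0) = 1" using bspec[OF le, of 0] by simp
  then have "\<psi> constant_on unit_disc"
    using maximum_modulus_principle[OF hol open_ball _ open_ball order_refl, of 0] le by simp
  then have const: "\<psi> z = \<psi> 0" if "z \<in> unit_disc" for z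
    using that by (auto simp: constant_on_def)
  show ?thesis
  proof (rule that[of "\<lambda>_. 0"])
    show "\<psi> z - \<psi> 0 = z * 0 * (1 - cnj (\<psi> 0) * \<psi> z)" if "z \<in> unit_disc" for z
      unfolding const[OF that] by simp
  qed simp_all
qed

text \<open>The coefficients of order 1 and 2 in the equation of \<open>Schur_step\<close>. Since
  \<open>\<kappa>\<close> satisfies the same hypotheses as \<open>\<psi>\<close>, the lemma can be
  applied to it again.\<close>

lemma Schur_coeffs:
  fixes \<psi> :: "complex \<Rightarrow> complex"
  assumes hol: "\<psi> holomorphic_on unit_disc"
    and le: "\<forall>z\<in>unit_disc. norm (\<psi> z) \<le> 1"
    and F: "\<psi> has_fps_expansion F"
  obtains \<kappa> :: "complex \<Rightarrow> complex" and H where "\<kappa> holomorphic_on unit_disc"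
    "\<forall>z\<in>unit_disc. norm (\<kappa> z) \<le> 1"
    "\<kappa> has_fps_expansion H"
    "F $ 1 = (1 - (norm (F $ 0))\<^sup>2) * H $ 0"
    "F $ 2 = (1 - (norm (F $ 0))\<^sup>2) * H $ 1 - cnj (F $ 0) * H $ 0 * F $ 1"
proof -
  obtain \<kappa> :: "complex \<Rightarrow> complex" where \<kappa>: "\<kappa> holomorphic_on unit_disc"
    "\<forall>z\<in>unit_disc. norm (\<kappa> z) \<le> 1"
    "\<And>z. z \<in> unit_disc \<Longrightarrow> \<psi> z - \<psi> 0 = z * \<kappa> z * (1 - cnj (\<psi> 0) * \<psi> z)"
    using Schur_step[OF hol le] by blast
  define H where "H = fps_expansion \<kappa> 0"
  have H: "\<kappa> has_fps_expansion H"
    unfolding H_def by (rule has_fps_expansion_fps_expansion[OF open_ball _ \<kappa>(1)]) simp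
  have F0: "\<psi> 0 = F $ 0" using has_fps_expansion_imp_0_eq_fps_nth_0[OF F] .
  have ev: "eventually (\<lambda>z. \<psi> z - F $ 0 = z * (\<kappa> z * (1 - cnj (F $ 0) * \<psi> z))) (nhds 0)"
    using eventually_nhds_in_open[of unit_disc 0]
    by (rule eventually_mono[rotated 2]) (use \<kappa>(3) F0 in \<open>auto simp: mult.assoc\<close>)
  have 1: "(\<lambda>z. \<psi> z - F $ 0) has_fps_expansion F - fps_const (F $ 0)"
    by (intro fps_expansion_intros F)
  have 2: "(\<lambda>z. z * (\<kappa> z * (1 - cnj (F $ 0) * \<psi> z))) has_fps_expansion
             fps_X * (H * (1 - fps_const (cnj (F $ 0)) * F))"
    by (intro fps_expansion_intros F H)
  have eq: "F - fps_const (F $ 0) = fps_X * (H * (1 - fps_const (cnj (F $ 0)) * F))"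
    by (rule fps_expansion_eq_if_eventually_eq[OF 1 2 ev])
  have n: "complex_of_real (1 - (norm (F $ 0))\<^sup>2) = 1 - cnj (F $ 0) * F $ 0"
    using complex_norm_square[of "F $ 0"] by (simp add: mult.commute)
  show ?thesis
  proof (rule that[OF \<kappa>(1,2) H])
    show "F $ 1 = (1 - (norm (F $ 0))\<^sup>2) * H $ 0"
      unfolding n using arg_cong[OF eq, of "\<lambda>P. P $ 1"] by (simp add: mult.commute)
    show "F $ 2 = (1 - (norm (F $ 0))\<^sup>2) * H $ 1 - cnj (F $ 0) * H $ 0 * F $ 1"
      unfolding n using arg_cong[OF eq, of "\<lambda>P. P $ 2"] by (simp add: mult_ac)
  qed
qed

text \<open>Division by \<open>z\<close> shifts the coefficients by one. A first Schur step then
  produces \<open>x\<close>, a second one produces \<open>y\<close>; both are values at 0 of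
  functions bounded by 1.\<close>

lemma Schwarz_coeffs:
  fixes \<omega> :: "complex \<Rightarrow> complex"
  assumes hol: "\<omega> holomorphic_on unit_disc" and "\<omega> 0 = 0"
    and le: "\<forall>z\<in>unit_disc. norm (\<omega> z) \<le> 1"
    and W: "\<omega> has_fps_expansion W"
  obtains x y :: complex where "norm (W $ 1) \<le> 1" "norm x \<le> 1" "norm y \<le> 1"
    "W $ 2 = (1 - (norm (W $ 1))\<^sup>2) * x"
    "W $ 3 = (1 - (norm (W $ 1))\<^sup>2) * ((1 - (norm x)\<^sup>2) * y - cnj (W $ 1) * x\<^sup>2)"
proof -
  have less: "\<forall>z\<in>unit_disc. norm (\<omega> z) < 1"
    using norm_less_1_of_norm_le_1[OF hol le] \<open>\<omega> 0 = 0\<close> by simp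
  obtain \<psi> :: "complex \<Rightarrow> complex" where \<psi>: "\<psi> holomorphic_on unit_disc"
    "\<forall>z\<in>unit_disc. norm (\<psi> z) \<le> 1"
    "\<And>z. z \<in> unit_disc \<Longrightarrow> \<omega> z = z * \<psi> z"
    by (rule Schwarz_quotient[OF hol \<open>\<omega> 0 = 0\<close> less]) (use that in blast)
  define F where "F = fps_expansion \<psi> 0"
  have F: "\<psi> has_fps_expansion F"
    unfolding F_def by (rule has_fps_expansion_fps_expansion[OF open_ball _ \<psi>(1)]) simp
  have ev: "eventually (\<lambda>z. \<omega> z = z * \<psi> z) (nhds 0)"
    using eventually_nhds_in_open[of unit_disc 0]
    by (rule eventually_mono[rotated 2]) (use \<psi>(3) in auto)
  have "(\<lambda>z. z * \<psi> z) has_fps_expansion fps_X * F"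
    by (intro fps_expansion_intros F)
  from fps_expansion_eq_if_eventually_eq[OF W this ev] have "W = fps_X * F" .
  then have WF: "W $ 1 = F $ 0" "W $ 2 = F $ 1" "W $ 3 = F $ 2" by simp_all
  obtain \<kappa> :: "complex \<Rightarrow> complex" and H where \<kappa>: "\<kappa> holomorphic_on unit_disc"
    "\<forall>z\<in>unit_disc. norm (\<kappa> z) \<le> 1"
    "\<kappa> has_fps_expansion H"
    "F $ 1 = (1 - (norm (F $ 0))\<^sup>2) * H $ 0"
    "F $ 2 = (1 - (norm (F $ 0))\<^sup>2) * H $ 1 - cnj (F $ 0) * H $ 0 * F $ 1"
    by (rule Schur_coeffs[OF \<psi>(1,2) F])
  obtain \<eta> :: "complex \<Rightarrow> complex" and G where \<eta>: "\<eta> holomorphic_on unit_disc"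
    "\<forall>z\<in>unit_disc. norm (\<eta> z) \<le> 1"
    "\<eta> has_fps_expansion G" "H $ 1 = (1 - (norm (H $ 0))\<^sup>2) * G $ 0"
    "H $ 2 = (1 - (norm (H $ 0))\<^sup>2) * G $ 1 - cnj (H $ 0) * G $ 0 * H $ 1"
    by (rule Schur_coeffs[OF \<kappa>(1,2,3)])
  show ?thesis
  proof (rule that)
    show "norm (W $ 1) \<le> 1"
      using bspec[OF \<psi>(2), of 0] has_fps_expansion_imp_0_eq_fps_nth_0[OF F] WF by simp
    show "norm (H $ 0) \<le> 1" "norm (G $ 0) \<le> 1"
      using bspec[OF \<kappa>(2), of 0] has_fps_expansion_imp_0_eq_fps_nth_0[OF \<kappa>(3)]
        bspec[OF \<eta>(2), of 0] has_fps_expansion_imp_0_eq_fps_nth_0[OF \<eta>(3)] by simp_all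
    show "W $ 2 = (1 - (norm (W $ 1))\<^sup>2) * H $ 0"
      unfolding WF by (rule \<kappa>(4))
    show "W $ 3 = (1 - (norm (W $ 1))\<^sup>2) *
        ((1 - (norm (H $ 0))\<^sup>2) * G $ 0 - cnj (W $ 1) * (H $ 0)\<^sup>2)"
      unfolding WF \<kappa>(5) \<eta>(4) \<kappa>(4)
      by (simp only: right_diff_distrib mult_ac power2_eq_square)
  qed
qed

section \<open>The inequality of Prokhorov and Szynal\<close>

text \<open>
  With \<open>u = Re w\<close> and \<open>q = \<bar>w\<bar>\<^sup>2\<close> the bracket is \<open>\<bar>\<mu> t\<^sup>2 + d (\<sigma> w - w\<^sup>2)\<bar>\<^sup>2\<close>.
\<close>
lemma cubic_bound_aux:
  fixes t q u \<sigma> \<mu> :: real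
  assumes t: "0 \<le> t" "t \<le> 1" and q: "0 \<le> q" "q \<le> 1" and "1 \<le> \<mu>" "\<sigma>\<^sup>2 \<le> 12 * \<mu> - 8"
  defines "d \<equiv> 1 - t\<^sup>2"
  shows "t\<^sup>2 * ((\<mu> * t\<^sup>2 + d * q)\<^sup>2 + d\<^sup>2 * \<sigma>\<^sup>2 * q + 2 * d * \<sigma> * (\<mu> * t\<^sup>2 - d * q) * u
            - 4 * \<mu> * t\<^sup>2 * d * u\<^sup>2) \<le> (\<mu> - d + d * q)\<^sup>2"
    (is "?L \<le> _")
proof -
  define M where "M = \<mu> * t\<^sup>2 + d * q"
  define K where "K = \<mu> * t\<^sup>2 - d * q"
  have d: "0 \<le> d" "d \<le> 1" using t by (simp_all add: d_def power_le_one)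
  have td: "t\<^sup>2 = 1 - d" by (simp add: d_def)
  have M0: "0 \<le> M" using d q assms(5) by (simp add: M_def)
  have "d * q \<le> d * \<mu>" using q d assms(5) by (intro mult_left_mono) auto
  then have M\<mu>: "M \<le> \<mu>" unfolding M_def td by (simp add: algebra_simps)
  text \<open>Completing the square in \<open>u\<close> bounds the left-hand side by its maximum over all real \<open>u\<close>.\<close>
  have "0 \<le> d / (4 * \<mu>) * (\<sigma> * K - 4 * \<mu> * t\<^sup>2 * u)\<^sup>2" using d assms(5) by simp
  also have "\<dots> = d * \<sigma>\<^sup>2 * K\<^sup>2 / (4 * \<mu>) - t\<^sup>2 * (2 * d * \<sigma> * K * u - 4 * \<mu> * t\<^sup>2 * d * u\<^sup>2)"
    using assms(5) by (simp add: field_simps power2_eq_square)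
  finally have "?L \<le> t\<^sup>2 * (M\<^sup>2 + d\<^sup>2 * \<sigma>\<^sup>2 * q) + d * \<sigma>\<^sup>2 * K\<^sup>2 / (4 * \<mu>)"
    by (simp add: M_def K_def algebra_simps)
  \<comment> \<open>After this substitution the terms with \<open>\<sigma>\<^sup>2 * q\<close>
    cancel, so that \<open>M\<^sup>2\<close> can be factored out.\<close>
  also have "K\<^sup>2 = M\<^sup>2 - 4 * \<mu> * t\<^sup>2 * d * q" by (simp add: K_def M_def power2_eq_square algebra_simps)
  also have "t\<^sup>2 * (M\<^sup>2 + d\<^sup>2 * \<sigma>\<^sup>2 * q) + d * \<sigma>\<^sup>2 * (M\<^sup>2 - 4 * \<mu> * t\<^sup>2 * d * q) / (4 * \<mu>)
      = M\<^sup>2 * (t\<^sup>2 + d * (\<sigma>\<^sup>2 / (4 * \<mu>)))"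
    using assms(5) by (simp add: field_simps power2_eq_square)
  \<comment> \<open>The parabola enters here: \<open>\<sigma>\<^sup>2 / (4 * \<mu>)\<close> is at
    most \<open>3 - 2 / \<mu>\<close>. As \<open>t\<^sup>2 = 1 - d\<close>, the factor of
    \<open>M\<^sup>2\<close> becomes \<open>1 + 2 * d * (\<mu> - 1) / \<mu>\<close>.\<close>
  also have "\<dots> \<le> M\<^sup>2 * (t\<^sup>2 + d * ((12 * \<mu> - 8) / (4 * \<mu>)))"
    using assms(5,6) d by (intro mult_left_mono add_left_mono divide_right_mono) auto
  also have "\<dots> = M\<^sup>2 + 2 * d * (\<mu> - 1) * (M * (M / \<mu>))"
    unfolding td using assms(5) by (simp add: field_simps power2_eq_square)
  \<comment> \<open>Once \<open>M / \<mu>\<close> is replaced by 1, these are the first two terms of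
    the square of \<open>M + (\<mu> - 1) * d\<close>, which is the number squared in the
    claim.\<close>
  also have "\<dots> \<le> M\<^sup>2 + 2 * d * (\<mu> - 1) * (M * 1)"
    using M0 M\<mu> assms(5) d by (intro add_left_mono mult_left_mono) auto
  also have "\<dots> = (M + (\<mu> - 1) * d)\<^sup>2 - ((\<mu> - 1) * d)\<^sup>2"
    by (simp add: power2_eq_square algebra_simps)
  also have "\<dots> \<le> (M + (\<mu> - 1) * d)\<^sup>2" by simp
  also have "M + (\<mu> - 1) * d = \<mu> - d + d * q" by (simp add: M_def td algebra_simps)
  finally show ?thesis .
qed

text \<open>The product subtracted on the right is the largest modulus of the term in
  \<open>y\<close> in the next lemma, so the two estimates will add up to \<open>\<mu>\<close>.
  Roots may be taken in the squared estimate because its right-hand side is the square of a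
  nonnegative number.\<close>

lemma cubic_bound:
  fixes w :: complex and t \<sigma> \<mu> :: real
  assumes t: "0 \<le> t" "t \<le> 1" and w: "norm w \<le> 1" and "1 \<le> \<mu>" "\<sigma>\<^sup>2 \<le> 12 * \<mu> - 8"
  shows "t * norm (\<mu> * t\<^sup>2 + (1 - t\<^sup>2) * (\<sigma> * w - w\<^sup>2)) \<le> \<mu> - (1 - t\<^sup>2) * (1 - (norm w)\<^sup>2)"
proof -
  define d where "d = 1 - t\<^sup>2"
  define q where "q = (norm w)\<^sup>2"
  have q: "0 \<le> q" "q \<le> 1" using w by (simp_all add: q_def power_le_one)
  have d: "0 \<le> d" "d \<le> 1" using t by (simp_all add: d_def power_le_one)
  have q': "q = (Re w)\<^sup>2 + (Im w)\<^sup>2" by (simp add: q_def cmod_power2)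
  have "(norm (\<mu> * t\<^sup>2 + d * (\<sigma> * w - w\<^sup>2)))\<^sup>2 = (\<mu> * t\<^sup>2 + d * q)\<^sup>2 + d\<^sup>2 * \<sigma>\<^sup>2 * q
      + 2 * d * \<sigma> * (\<mu> * t\<^sup>2 - d * q) * Re w - 4 * \<mu> * t\<^sup>2 * d * (Re w)\<^sup>2"
    unfolding cmod_power2 q' by (simp add: power2_eq_square algebra_simps)
  then have "(t * norm (\<mu> * t\<^sup>2 + d * (\<sigma> * w - w\<^sup>2)))\<^sup>2 \<le> (\<mu> - d + d * q)\<^sup>2"
    using cubic_bound_aux[OF t q assms(4,5), of "Re w"] by (simp add: power_mult_distrib d_def)
  moreover have "0 \<le> \<mu> - d + d * q" using assms(4) d q by (simp add: add_nonneg_nonneg)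
  ultimately have "t * norm (\<mu> * t\<^sup>2 + d * (\<sigma> * w - w\<^sup>2)) \<le> \<mu> - d + d * q"
    by (rule power2_le_imp_le)
  then show ?thesis by (simp add: d_def q_def algebra_simps)
qed

text \<open>The term in \<open>y\<close> has modulus at most
  \<open>D * (1 - (norm x)\<^sup>2)\<close>. The remainder \<open>Z\<close> involves two complex
  numbers; rotating \<open>x\<close> leaves only the modulus of \<open>c\<close> and one complex
  number, as in \<open>cubic_bound\<close>.\<close>

lemma Prokhorov_Szynal_parabola:
  fixes c x y :: complex and \<sigma> \<mu> :: real
  assumes c: "norm c \<le> 1" and x: "norm x \<le> 1" and y: "norm y \<le> 1"
    and "1 \<le> \<mu>" "\<sigma>\<^sup>2 \<le> 12 * \<mu> - 8"
  defines "D \<equiv> 1 - (norm c)\<^sup>2"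
  shows "norm (D * ((1 - (norm x)\<^sup>2) * y - cnj c * x\<^sup>2) + \<sigma> * c * (D * x) + \<mu> * c ^ 3) \<le> \<mu>"
proof -
  define Z where "Z = \<mu> * c ^ 3 + D * (\<sigma> * c * x - cnj c * x\<^sup>2)"
  have D: "0 \<le> D" "D \<le> 1" using c by (simp_all add: D_def power_le_one)
  have X: "0 \<le> 1 - (norm x)\<^sup>2" using x by (simp add: power_le_one)
  have Z: "norm Z \<le> \<mu> - D * (1 - (norm x)\<^sup>2)"
  proof (cases "c = 0")
    case True
    moreover have "1 - (norm x)\<^sup>2 \<le> \<mu>" using assms(4) zero_le_power2[of "norm x"] by linarith
    ultimately show ?thesis by (simp add: Z_def D_def)
  next
    case False
    define t where "t = norm c"
    \<comment> \<open>With this rotation, \<open>c * x\<close> and \<open>cnj c * x\<^sup>2\<close>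
      are \<open>w\<close> and \<open>w\<^sup>2\<close> times the common factor
      \<open>c ^ 3 / t\<^sup>2\<close>, whose modulus is \<open>t\<close>.\<close>
    define w where "w = x * (cnj c)\<^sup>2 / (complex_of_real t)\<^sup>2"
    have t: "0 < t" "t \<le> 1" using False c by (simp_all add: t_def)
    have cc: "c * cnj c = (complex_of_real t)\<^sup>2" by (simp add: t_def flip: complex_norm_square)
    have w: "norm w = norm x" using t by (simp add: w_def norm_mult norm_divide norm_power t_def)
    have "x = c\<^sup>2 * w / (complex_of_real t)\<^sup>2"
    proof -
      have "c\<^sup>2 * w = x * (c * cnj c)\<^sup>2 / (complex_of_real t)\<^sup>2" by (simp add: w_def power_mult_distrib)
      then show ?thesis unfolding cc using t by (simp add: power2_eq_square)
    qed
    then have "c * x = c ^ 3 / (complex_of_real t)\<^sup>2 * w"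
      and "cnj c * x\<^sup>2 = c ^ 3 * (c * cnj c) / (complex_of_real t) ^ 4 * w\<^sup>2"
      by (simp_all add: power_divide power_mult_distrib power2_eq_square power3_eq_cube power4_eq_xxxx mult_ac)
    then have cx: "c * x = c ^ 3 / (complex_of_real t)\<^sup>2 * w"
      and cx2: "cnj c * x\<^sup>2 = c ^ 3 / (complex_of_real t)\<^sup>2 * w\<^sup>2"
      unfolding cc using t by (simp_all add: field_simps power2_eq_square power4_eq_xxxx)
    have "Z = \<mu> * c ^ 3 + D * (\<sigma> * (c * x) - cnj c * x\<^sup>2)" by (simp add: Z_def mult.assoc)
    also have "\<dots> = c ^ 3 / (complex_of_real t)\<^sup>2 * (\<mu> * t\<^sup>2 + D * (\<sigma> * w - w\<^sup>2))"
      unfolding cx cx2 using t by (simp add: field_simps)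
    finally have "norm Z = norm (c ^ 3 / (complex_of_real t)\<^sup>2) * norm (\<mu> * t\<^sup>2 + D * (\<sigma> * w - w\<^sup>2))"
      by (metis norm_mult)
    also have "norm (c ^ 3 / (complex_of_real t)\<^sup>2) = t"
      using t by (simp add: norm_divide norm_power flip: t_def) (simp add: power2_eq_square power3_eq_cube)
    also have "t * norm (\<mu> * t\<^sup>2 + D * (\<sigma> * w - w\<^sup>2)) \<le> \<mu> - (1 - t\<^sup>2) * (1 - (norm w)\<^sup>2)"
      using cubic_bound[of t w \<mu> \<sigma>] t w x assms(4,5) by (simp add: D_def t_def)
    finally show ?thesis by (simp add: w D_def t_def)
  qed
  have "D * ((1 - (norm x)\<^sup>2) * y - cnj c * x\<^sup>2) + \<sigma> * c * (D * x) + \<mu> * c ^ 3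
      = complex_of_real (D * (1 - (norm x)\<^sup>2)) * y + Z"
    by (simp add: Z_def algebra_simps)
  also have "norm \<dots> \<le> D * (1 - (norm x)\<^sup>2) * norm y + norm Z"
    using norm_triangle_ineq[of "complex_of_real (D * (1 - (norm x)\<^sup>2)) * y" Z] D X
    by (simp add: norm_mult del: of_real_mult of_real_diff)
  also have "\<dots> \<le> D * (1 - (norm x)\<^sup>2) * 1 + norm Z"
    using D X y by (intro add_right_mono mult_left_mono) auto
  also have "\<dots> \<le> \<mu>" using Z by simp
  finally show ?thesis .
qed

text \<open>For \<open>t = norm c\<close> the triangle inequality gives the bound
  \<open>t - t ^ 3 / 3\<close>, which increases on the unit interval up to 2/3. The coefficient 2/3
  of the cube is the slope of the boundary of \<open>Omega3\<close>.\<close>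

lemma linear_plus_cubic_bound:
  fixes c x :: complex and s :: real
  assumes c: "norm c \<le> 1" and x: "norm x \<le> 1" and s: "\<bar>s\<bar> = 1"
  shows "norm (s * c * (complex_of_real (1 - (norm c)\<^sup>2) * x) + 2 / 3 * c ^ 3) \<le> 2 / 3"
proof -
  define t where "t = norm c"
  have t: "0 \<le> t" "t \<le> 1" and D: "0 \<le> 1 - t\<^sup>2" using c by (simp_all add: t_def power_le_one)
  have "norm (s * c * (complex_of_real (1 - (norm c)\<^sup>2) * x) + 2 / 3 * c ^ 3)
      \<le> norm (s * c * (complex_of_real (1 - t\<^sup>2) * x)) + norm (2 / 3 * c ^ 3)"
    unfolding t_def by (rule norm_triangle_ineq)
  also have "\<dots> = t * (1 - t\<^sup>2) * norm x + 2 / 3 * t ^ 3"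
    using D s by (simp add: norm_mult norm_power norm_divide del: of_real_diff flip: t_def)
  also have "\<dots> \<le> t * (1 - t\<^sup>2) * 1 + 2 / 3 * t ^ 3"
    using D t x by (intro add_right_mono mult_left_mono) auto
  \<comment> \<open>The distance to the maximal value has a double zero at \<open>t = 1\<close>,
    hence the square.\<close>
  also have "\<dots> = 2 / 3 - (1 - t)\<^sup>2 * (2 + t) / 3"
    by (simp add: power2_eq_square power3_eq_cube field_simps)
  also have "\<dots> \<le> 2 / 3" using t by simp
  finally show ?thesis .
qed

text \<open>
  \<open>Omega3\<close> is reached from \<open>\<bar>\<sigma>\<bar> = 4\<close> by adding \<open>\<bar>\<sigma>\<bar> - 4\<close> times
  the bound \<open>\<bar>\<plusminus> c\<^sub>1 c\<^sub>2 + 2/3 c\<^sub>1\<^sup>3\<bar> \<le> 2/3\<close>.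
\<close>
lemma Prokhorov_Szynal:
  fixes c x y :: complex and \<sigma> \<mu> :: real
  assumes c: "norm c \<le> 1" and x: "norm x \<le> 1" and y: "norm y \<le> 1"
    and \<Omega>: "(\<sigma>, \<mu>) \<in> Omega2 \<union> Omega3"
  defines "D \<equiv> 1 - (norm c)\<^sup>2"
  shows "norm (D * ((1 - (norm x)\<^sup>2) * y - cnj c * x\<^sup>2) + \<sigma> * c * (D * x) + \<mu> * c ^ 3) \<le> \<mu>"
  using \<Omega>
proof
  assume "(\<sigma>, \<mu>) \<in> Omega2"
  then have "2 \<le> \<bar>\<sigma>\<bar>" and \<mu>: "\<sigma>\<^sup>2 \<le> 12 * \<mu> - 8" by (auto simp: Omega2_def)
  \<comment> \<open>With \<open>\<sigma>\<^sup>2 \<le> 12 * \<mu> - 8\<close> this yields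
    \<open>1 \<le> \<mu>\<close>.\<close>
  then have "2\<^sup>2 \<le> \<sigma>\<^sup>2" by (metis abs_le_square_iff abs_numeral)
  then show ?thesis unfolding D_def
    using \<mu> by (intro Prokhorov_Szynal_parabola[OF c x y]) auto
next
  assume "(\<sigma>, \<mu>) \<in> Omega3"
  then have \<sigma>: "4 \<le> \<bar>\<sigma>\<bar>" and \<mu>: "2 / 3 * (\<bar>\<sigma>\<bar> - 1) \<le> \<mu>" by (auto simp: Omega3_def)
  define s where "s = sgn \<sigma>"
  define r where "r = \<bar>\<sigma>\<bar> - 4"
  \<comment> \<open>Going back along the slope 2/3 to first coordinate of modulus 4 leaves height
    \<open>m\<close>, at least 2. There the boundary line of \<open>Omega3\<close> touches the
    parabola, since (16 + 8) / 12 = 2, so \<open>(4 * s, m)\<close> satisfies the hypotheses of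
    \<open>Prokhorov_Szynal_parabola\<close>.\<close>
  define m where "m = \<mu> - 2 / 3 * r"
  have s: "\<bar>s\<bar> = 1" "s\<^sup>2 = 1" using \<sigma> by (auto simp: s_def sgn_if)
  have "\<sigma> = s * \<bar>\<sigma>\<bar>" by (simp add: s_def sgn_mult_abs)
  then have \<sigma>_eq: "\<sigma> = 4 * s + r * s" by (simp add: r_def algebra_simps)
  have r: "0 \<le> r" and m: "2 \<le> m" using \<sigma> \<mu> by (simp_all add: r_def m_def field_simps)
  let ?P = "D * ((1 - (norm x)\<^sup>2) * y - cnj c * x\<^sup>2) + (4 * s) * c * (D * x) + m * c ^ 3"
  let ?Q = "s * c * (D * x) + 2 / 3 * c ^ 3"
  have "D * ((1 - (norm x)\<^sup>2) * y - cnj c * x\<^sup>2) + \<sigma> * c * (D * x) + \<mu> * c ^ 3 = ?P + r * ?Q"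
    by (simp add: \<sigma>_eq m_def algebra_simps)
  also have "norm \<dots> \<le> norm ?P + r * norm ?Q"
    using norm_triangle_ineq[of ?P "r * ?Q"] r by (simp add: norm_mult)
  also have "\<dots> \<le> m + r * (2 / 3)"
  proof (intro add_mono mult_left_mono r)
    show "norm ?P \<le> m"
      using Prokhorov_Szynal_parabola[OF c x y, of m "4 * s"] m s(2) by (simp add: D_def power_mult_distrib)
    show "norm ?Q \<le> 2 / 3"
      using linear_plus_cubic_bound[OF c x s(1)] by (simp add: D_def)
  qed
  also have "\<dots> = \<mu>" by (simp add: m_def)
  finally show ?thesis .
qed

section \<open>Logarithmic coefficients of the inverse from the Taylor coefficients\<close>

lemma inv_log_coeff_eq:
  assumes f: "f \<in> class_A" and F: "f has_fps_expansion F"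
  shows "inv_log_coeff f 2 = - 1 / 2 * (F $ 3 - 3 / 2 * (F $ 2)\<^sup>2)"
    and "inv_log_coeff f 3 = - 1 / 2 * (F $ 4 - 4 * F $ 2 * F $ 3 + 10 / 3 * (F $ 2) ^ 3)"
proof -
  define g where "g = local_inverse f"
  obtain r where r: "r > 0" "g holomorphic_on ball 0 r" "g 0 = 0"
      "\<And>w. w \<in> ball 0 r \<Longrightarrow> g w \<in> unit_disc \<and> f (g w) = w"
    using local_inverse_exists[OF f] by (auto simp: is_local_inverse_def g_def)
  define G where "G = fps_expansion g 0"
  have G: "g has_fps_expansion G"
    unfolding G_def by (rule has_fps_expansion_fps_expansion[OF open_ball _ r(2)]) (use r in simp)
  have G0: "G $ 0 = 0" using has_fps_expansion_imp_0_eq_fps_nth_0[OF G] r(3) by simp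
  have ev_r: "eventually (\<lambda>w. w \<in> ball 0 r) (nhds (0::complex))"
    using r(1) by (intro eventually_nhds_in_open) auto
  have f0: "f 0 = 0" and F1: "F $ 1 = 1"
    using f fps_nth_fps_expansion[OF F, of 1] by (auto simp: class_A_def)
  have "eventually (\<lambda>w. (f \<circ> g) w = w) (nhds 0)"
    using ev_r by eventually_elim (use r(4) in auto)
  then have FG: "F oo G = fps_X"
    by (rule fps_expansion_eq_if_eventually_eq[OF has_fps_expansion_compose[OF F G G0]
          has_fps_expansion_fps_X])
  define L where "L = Abs_fps (\<lambda>n. 2 * inv_log_coeff f n)"
  have L: "F_inv f has_fps_expansion L"
    by (rule has_fps_expansionI) (use inv_log_coeff_sums[OF f] in \<open>simp add: L_def\<close>)
  have L0: "L $ 0 = 0"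
    using has_fps_expansion_imp_0_eq_fps_nth_0[OF L] by (simp add: F_inv_def)
  \<comment> \<open>Exponentiating replaces the logarithm by a composition of power series. The
    branch does not matter, as \<open>exp (Ln u) = u\<close> for nonzero \<open>u\<close>, and
    \<open>g w\<close> is nonzero for nonzero \<open>w\<close> because
    \<open>f 0 = 0\<close>.\<close>
  have "eventually (\<lambda>w. g w = w * (exp \<circ> F_inv f) w) (nhds 0)"
    using ev_r
  proof eventually_elim
    case (elim w)
    then have "w \<noteq> 0 \<Longrightarrow> g w \<noteq> 0" using r(4)[of w] f0 by auto
    then show ?case using r(3) by (simp add: F_inv_def g_def[symmetric] exp_Ln)
  qed
  moreover have "(\<lambda>w. w * (exp \<circ> F_inv f) w) has_fps_expansion fps_X * (fps_exp 1 oo L)"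
    by (intro fps_expansion_intros L L0)
  ultimately have GL: "G = fps_X * (fps_exp 1 oo L)"
    using fps_expansion_eq_if_eventually_eq[OF G] by blast
  have G1: "G $ 1 = 1"
    and G2: "G $ 2 = L $ 1"
    and G3: "G $ 3 = L $ 2 + (L $ 1)\<^sup>2 / 2"
    and G4: "G $ 4 = L $ 3 + L $ 1 * L $ 2 + (L $ 1) ^ 3 / 6"
    using fps_compose_nth_low[OF L0, of "fps_exp 1"]
    by (simp_all add: GL fact_numeral)
  have e1: "G $ 2 + F $ 2 = 0"
    and e2: "G $ 3 + 2 * F $ 2 * G $ 2 + F $ 3 = 0"
    and e3: "G $ 4 + F $ 2 * (2 * G $ 3 + (G $ 2)\<^sup>2) + 3 * F $ 3 * G $ 2 + F $ 4 = 0"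
    using fps_compose_nth_low(2-)[OF G0, of F] unfolding FG F1 G1 by simp_all
  have L1: "L $ 1 = - F $ 2" using e1 unfolding G2 by (simp add: eq_neg_iff_add_eq_0)
  \<comment> \<open>The last bracket is the left-hand side of \<open>e2\<close>, hence zero; adding
    it makes the equation a polynomial identity. The same is done with \<open>e3\<close>
    below.\<close>
  have "L $ 2 = - (F $ 3 - 3 / 2 * (F $ 2)\<^sup>2) + (G $ 3 + 2 * F $ 2 * G $ 2 + F $ 3)"
    unfolding G2 G3 L1 by (simp add: field_simps power2_eq_square)
  then have L2: "L $ 2 = - (F $ 3 - 3 / 2 * (F $ 2)\<^sup>2)" unfolding e2 by simp
  have "L $ 3 = - (F $ 4 - 4 * F $ 2 * F $ 3 + 10 / 3 * (F $ 2) ^ 3)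
      + (G $ 4 + F $ 2 * (2 * G $ 3 + (G $ 2)\<^sup>2) + 3 * F $ 3 * G $ 2 + F $ 4)"
    unfolding G2 G3 G4 L1 L2 by (simp add: field_simps power2_eq_square power3_eq_cube)
  then have L3: "L $ 3 = - (F $ 4 - 4 * F $ 2 * F $ 3 + 10 / 3 * (F $ 2) ^ 3)" unfolding e3 by simp
  show "inv_log_coeff f 2 = - 1 / 2 * (F $ 3 - 3 / 2 * (F $ 2)\<^sup>2)"
    and "inv_log_coeff f 3 = - 1 / 2 * (F $ 4 - 4 * F $ 2 * F $ 3 + 10 / 3 * (F $ 2) ^ 3)"
    using L2 L3 by (simp_all add: L_def field_simps)
qed

section \<open>Members of \<open>class_C\<close>: their coefficients and their construction\<close>

lemma ma_minda_has_fps_expansion: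
  assumes "ma_minda \<phi>"
  shows "\<phi> has_fps_expansion Abs_fps (\<lambda>n. complex_of_real (mm_coeff \<phi> n))"
proof (rule has_fps_expansionI)
  have "eventually (\<lambda>z. z \<in> unit_disc) (nhds (0::complex))"
    by (intro eventually_nhds_in_open) auto
  then show "eventually (\<lambda>z. (\<lambda>n. Abs_fps (\<lambda>n. complex_of_real (mm_coeff \<phi> n)) $ n * z ^ n)
      sums \<phi> z) (nhds 0)"
    by eventually_elim (use ma_minda_sums[OF assms] in simp)
qed

text \<open>Clearing the denominator gives
  \<open>z * f'' = f' * (\<phi> \<circ> \<omega> - 1)\<close>, a recursion for the coefficients of
  \<open>f\<close>. The coefficients of \<open>Q\<close> stay symbolic until the end because both
  logarithmic coefficients are short polynomials in them.\<close>

lemma class_C_inv_log_coeff: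
  fixes W :: "complex fps" and B1 B2 B3 :: real
  assumes \<phi>: "ma_minda \<phi>" and f: "f \<in> class_A" and nz: "\<forall>z\<in>unit_disc. deriv f z \<noteq> 0"
    and eq: "\<forall>z\<in>unit_disc. 1 + z * deriv (deriv f) z / deriv f z = \<phi> (\<omega> z)"
    and W: "\<omega> has_fps_expansion W" and "\<omega> 0 = 0"
    and B: "B1 = mm_coeff \<phi> 1" "B2 = mm_coeff \<phi> 2" "B3 = mm_coeff \<phi> 3"
  shows "inv_log_coeff f 2 = - 1 / 12 * (B1 * W $ 2 + (B2 - 5 / 4 * B1\<^sup>2) * (W $ 1)\<^sup>2)"
    and "inv_log_coeff f 3 = - 1 / 24 * (B1 * W $ 3 - (5 / 2 * B1\<^sup>2 - 2 * B2) * W $ 1 * W $ 2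
           + (3 / 2 * B1 ^ 3 - 5 / 2 * B1 * B2 + B3) * (W $ 1) ^ 3)"
proof -
  define P where "P = Abs_fps (\<lambda>n. complex_of_real (mm_coeff \<phi> n))"
  have P: "\<phi> has_fps_expansion P"
    unfolding P_def by (rule ma_minda_has_fps_expansion[OF \<phi>])
  have P0: "P $ 0 = 1" and P1: "P $ 1 = B1" and P2: "P $ 2 = B2" and P3: "P $ 3 = B3"
    using has_fps_expansion_imp_0_eq_fps_nth_0[OF P] \<phi> by (auto simp: ma_minda_def P_def B)
  have W0: "W $ 0 = 0" using has_fps_expansion_imp_0_eq_fps_nth_0[OF W] \<open>\<omega> 0 = 0\<close> by simp
  define F where "F = fps_expansion f 0"
  have hol: "f holomorphic_on unit_disc" using f by (simp add: class_A_def)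
  have F: "f has_fps_expansion F"
    unfolding F_def by (rule has_fps_expansion_fps_expansion[OF open_ball _ hol]) simp
  have F1: "F $ 1 = 1"
    using f fps_nth_fps_expansion[OF F, of 1] by (auto simp: class_A_def)
  define Q where "Q = (P oo W) - 1"
  have ev: "eventually (\<lambda>z. z * deriv (deriv f) z = deriv f z * ((\<phi> \<circ> \<omega>) z - 1)) (nhds 0)"
  proof -
    have "eventually (\<lambda>z. z \<in> unit_disc) (nhds (0::complex))"
      by (intro eventually_nhds_in_open) auto
    then show ?thesis
    proof eventually_elim
      case (elim z)
      have "(\<phi> \<circ> \<omega>) z = 1 + z * deriv (deriv f) z / deriv f z" using eq elim by simp
      then show ?case using nz elim by simp
    qed
  qed
  have 1: "(\<lambda>z. z * deriv (deriv f) z) has_fps_expansion fps_X * fps_deriv (fps_deriv F)"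
    by (intro fps_expansion_intros F)
  have 2: "(\<lambda>z. deriv f z * ((\<phi> \<circ> \<omega>) z - 1)) has_fps_expansion fps_deriv F * Q"
    unfolding Q_def by (intro fps_expansion_intros F P W W0)
  have E: "fps_X * fps_deriv (fps_deriv F) = fps_deriv F * Q"
    by (rule fps_expansion_eq_if_eventually_eq[OF 1 2 ev])
  have Q0: "Q $ 0 = 0" using P0 by (simp add: Q_def)
  have Q1: "Q $ 1 = B1 * W $ 1" 
    and Q2: "Q $ 2 = B1 * W $ 2 + B2 * (W $ 1)\<^sup>2"
    and Q3: "Q $ 3 = B1 * W $ 3 + 2 * B2 * W $ 1 * W $ 2 + B3 * (W $ 1) ^ 3"
    using fps_compose_nth_low[OF W0, of P] P1 P2 P3 by (simp_all add: Q_def)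
  have E1: "2 * F $ 2 = Q $ 1"
    using arg_cong[OF E, of "\<lambda>R. R $ 1"] F1 Q0 by (simp add: eval_nat_numeral)
  have E2: "6 * F $ 3 = Q $ 2 + 2 * F $ 2 * Q $ 1"
    using arg_cong[OF E, of "\<lambda>R. R $ 2"] F1 Q0
    by (simp add: fps_mult_nth_low flip: numeral_2_eq_2 numeral_3_eq_3)
  have E3: "12 * F $ 4 = Q $ 3 + 2 * F $ 2 * Q $ 2 + 3 * F $ 3 * Q $ 1"
    using arg_cong[OF E, of "\<lambda>R. R $ 3"] F1 Q0
    by (simp add: fps_mult_nth_low flip: numeral_2_eq_2)
  have F2: "F $ 2 = Q $ 1 / 2" using E1 by (simp add: field_simps)
  have F3: "F $ 3 = (Q $ 2 + (Q $ 1)\<^sup>2) / 6"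
    using E2 unfolding E1 by (simp add: power2_eq_square field_simps)
  have "F $ 4 = 12 * F $ 4 / 12" by simp
  also have "12 * F $ 4 = Q $ 3 + 3 / 2 * Q $ 1 * Q $ 2 + (Q $ 1) ^ 3 / 2"
    unfolding E3 E1 F3 by (simp add: field_simps power2_eq_square power3_eq_cube)
  finally have F4: "F $ 4 = (Q $ 3 + 3 / 2 * Q $ 1 * Q $ 2 + (Q $ 1) ^ 3 / 2) / 12" .
  have "inv_log_coeff f 2 = - 1 / 12 * (Q $ 2 - 5 / 4 * (Q $ 1)\<^sup>2)"
    unfolding inv_log_coeff_eq[OF f F] F2 F3
    by (simp add: field_simps power2_eq_square)
  then show "inv_log_coeff f 2 = - 1 / 12 * (B1 * W $ 2 + (B2 - 5 / 4 * B1\<^sup>2) * (W $ 1)\<^sup>2)"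
    unfolding Q1 Q2 by (simp add: field_simps power2_eq_square)
  have "inv_log_coeff f 3 = - 1 / 24 * (Q $ 3 - 5 / 2 * Q $ 1 * Q $ 2 + 3 / 2 * (Q $ 1) ^ 3)"
    unfolding inv_log_coeff_eq[OF f F] F2 F3 F4
    by (simp add: field_simps power2_eq_square power3_eq_cube)
  also have "Q $ 3 - 5 / 2 * Q $ 1 * Q $ 2 + 3 / 2 * (Q $ 1) ^ 3
      = B1 * W $ 3 - (5 / 2 * B1\<^sup>2 - 2 * B2) * W $ 1 * W $ 2
        + (3 / 2 * B1 ^ 3 - 5 / 2 * B1 * B2 + B3) * (W $ 1) ^ 3"
    unfolding Q1 Q2 Q3 by (simp add: field_simps power2_eq_square power3_eq_cube)
  finally show "inv_log_coeff f 3 = - 1 / 24 * (B1 * W $ 3 - (5 / 2 * B1\<^sup>2 - 2 * B2) * W $ 1 * W $ 2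
           + (3 / 2 * B1 ^ 3 - 5 / 2 * B1 * B2 + B3) * (W $ 1) ^ 3)" .
qed

text \<open>The equation is solved by two integrations: the logarithmic derivative of
  \<open>f'\<close> must be \<open>(\<phi> (\<omega> z) - 1) / z\<close>, whose singularity at 0 is
  removable.\<close>

lemma class_C_exists:
  assumes \<phi>: "ma_minda \<phi>" and \<omega>: "\<omega> holomorphic_on unit_disc" "\<omega> 0 = 0"
    "\<forall>z\<in>unit_disc. norm (\<omega> z) \<le> 1"
  obtains f where "f \<in> class_C \<phi>" "\<forall>z\<in>unit_disc. 1 + z * deriv (deriv f) z / deriv f z = \<phi> (\<omega> z)"
proof -
  have hol\<phi>: "\<phi> holomorphic_on unit_disc" and \<phi>0: "\<phi> 0 = 1" using \<phi> by (auto simp: ma_minda_def)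
  have less: "norm (\<omega> z) < 1" if "z \<in> unit_disc" for z
    using norm_less_1_of_norm_le_1[OF \<omega>(1,3)] that \<omega>(2) by simp
  have hol: "(\<lambda>z. \<phi> (\<omega> z)) holomorphic_on unit_disc"
    unfolding o_def[symmetric] using less
    by (intro holomorphic_on_compose_gen[OF \<omega>(1) hol\<phi>]) auto
  then have "(\<lambda>z. \<phi> (\<omega> z) - 1) holomorphic_on unit_disc" by (intro holomorphic_intros)
  then obtain h where h: "h holomorphic_on unit_disc"
    "\<And>z. norm z < 1 \<Longrightarrow> \<phi> (\<omega> z) - 1 = z * h z"
    using Schwarz3[of "\<lambda>z. \<phi> (\<omega> z) - 1" 1] \<phi>0 \<omega>(2) by auto
  obtain p where p: "\<And>z. z \<in> unit_disc \<Longrightarrow> (p has_field_derivative h z) (at z)"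
    using holomorphic_convex_primitive'[OF convex_ball open_ball h(1)]
    by (metis at_within_open open_ball)
  \<comment> \<open>This is to be \<open>f'\<close>: the exponential has no zeros, and subtracting
    \<open>p 0\<close> makes its value at 0 equal to 1.\<close>
  define e where "e z = exp (p z - p 0)" for z
  have e: "(e has_field_derivative e z * h z) (at z)" if "z \<in> unit_disc" for z
    unfolding e_def by (rule derivative_eq_intros p that refl | simp)+
  then have "e holomorphic_on unit_disc" unfolding holomorphic_on_open[OF open_ball] by blast
  then obtain k where k: "\<And>z. z \<in> unit_disc \<Longrightarrow> (k has_field_derivative e z) (at z)"
    using holomorphic_convex_primitive'[OF convex_ball open_ball]
    by (metis at_within_open open_ball)
  define f where "f z = k z - k 0" for z
  have f: "(f has_field_derivative e z) (at z)" if "z \<in> unit_disc" for z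
    unfolding f_def by (rule derivative_eq_intros k that refl | simp)+
  have df: "deriv f z = e z" if "z \<in> unit_disc" for z
    using DERIV_imp_deriv[OF f[OF that]] .
  have ddf: "deriv (deriv f) z = e z * h z" if "z \<in> unit_disc" for z
  proof -
    have "eventually (\<lambda>z. z \<in> unit_disc) (nhds z)"
      using that by (intro eventually_nhds_in_open) auto
    then have "eventually (\<lambda>z. deriv f z = e z) (nhds z)"
      by eventually_elim (rule df)
    then have "deriv (deriv f) z = deriv e z" by (rule deriv_cong_ev) simp
    then show ?thesis using DERIV_imp_deriv[OF e[OF that]] by simp
  qed
  have nz: "e z \<noteq> 0" for z by (simp add: e_def)
  have eq: "1 + z * deriv (deriv f) z / deriv f z = \<phi> (\<omega> z)" if "z \<in> unit_disc" for z
    using h(2)[of z] that by (simp add: df ddf nz) (simp add: algebra_simps)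
  have "f \<in> class_A"
    unfolding class_A_def mem_Collect_eq holomorphic_on_open[OF open_ball]
    using df[of 0] by (auto intro: f simp: f_def[of 0] e_def[of 0])
  moreover have "(\<lambda>z. 1 + z * deriv (deriv f) z / deriv f z) holomorphic_on unit_disc"
    using holomorphic_transform[OF hol, of "\<lambda>z. 1 + z * deriv (deriv f) z / deriv f z"] eq by simp
  ultimately have "f \<in> class_C \<phi>"
    unfolding class_C_def subordinate_def using df nz hol\<phi> \<omega> eq by auto
  then show ?thesis using that eq by blast
qed

section \<open>The estimate and its sharpness\<close>

theorem theorem5:
  fixes \<phi> :: "complex \<Rightarrow> complex" and B1 B2 B3 \<sigma>2 \<mu>2 :: real
  assumes \<phi>: "ma_minda \<phi>"
    and B: "B1 = mm_coeff \<phi> 1" "B2 = mm_coeff \<phi> 2" "B3 = mm_coeff \<phi> 3"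
    and \<sigma>2: "\<sigma>2 = - (5 * B1\<^sup>2 - 4 * B2) / (2 * B1)"
    and \<mu>2: "\<mu>2 = (3 * B1 ^ 3 - 5 * B1 * B2 + 2 * B3) / (2 * B1)"
    and "\<bar>B2 - 5 / 4 * B1\<^sup>2\<bar> \<ge> B1"
    and "(\<sigma>2, \<mu>2) \<in> Omega2 \<union> Omega3"
  shows "(\<forall>f \<in> class_C \<phi>. norm (T22_inv f) \<le>
            1 / 144 * (B2 - 5 / 4 * B1\<^sup>2)\<^sup>2 + (3 * B1 ^ 3 - 5 * B1 * B2 + 2 * B3)\<^sup>2 / 2304)
       \<and> (\<exists>f \<in> class_C \<phi>. norm (T22_inv f) =
            1 / 144 * (B2 - 5 / 4 * B1\<^sup>2)\<^sup>2 + (3 * B1 ^ 3 - 5 * B1 * B2 + 2 * B3)\<^sup>2 / 2304)"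
proof -
  define A where "A = B2 - 5 / 4 * B1\<^sup>2"
  define M where "M = 3 * B1 ^ 3 - 5 * B1 * B2 + 2 * B3"
  have B1: "B1 > 0" using \<phi> by (simp add: B mm_coeff_def ma_minda_def)
  \<comment> \<open>\<open>\<sigma>2\<close> and \<open>\<mu>2\<close> arise when \<open>B1\<close>
    is taken out of the formula for the third coefficient; these products undo the division.\<close>
  have \<mu>B: "B1 * \<mu>2 = M / 2" and \<sigma>B: "B1 * \<sigma>2 = - (5 / 2 * B1\<^sup>2 - 2 * B2)"
    using B1 by (simp_all add: \<mu>2 \<sigma>2 M_def field_simps)
  have coeffs: "inv_log_coeff f 2 = - 1 / 12 * (B1 * W $ 2 + A * (W $ 1)\<^sup>2)"
    "inv_log_coeff f 3 = - 1 / 24 * (B1 * (W $ 3 + \<sigma>2 * W $ 1 * W $ 2 + \<mu>2 * (W $ 1) ^ 3))"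
    if f: "f \<in> class_C \<phi>" and eq: "\<forall>z\<in>unit_disc. 1 + z * deriv (deriv f) z / deriv f z = \<phi> (\<omega> z)"
      and W: "\<omega> has_fps_expansion W" "\<omega> 0 = 0" for f \<omega> and W :: "complex fps"
  proof -
    have f': "f \<in> class_A" "\<forall>z\<in>unit_disc. deriv f z \<noteq> 0" using f by (auto simp: class_C_def)
    note c = class_C_inv_log_coeff[OF \<phi> f' eq W B]
    show "inv_log_coeff f 2 = - 1 / 12 * (B1 * W $ 2 + A * (W $ 1)\<^sup>2)"
      using c(1) by (simp add: A_def)
    have "B1 * (W $ 3 + \<sigma>2 * W $ 1 * W $ 2 + \<mu>2 * (W $ 1) ^ 3)
        = B1 * W $ 3 + complex_of_real (B1 * \<sigma>2) * W $ 1 * W $ 2 + complex_of_real (B1 * \<mu>2) * (W $ 1) ^ 3"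
      by (simp add: algebra_simps)
    also have "\<dots> = B1 * W $ 3 - (5 / 2 * B1\<^sup>2 - 2 * B2) * W $ 1 * W $ 2
           + (3 / 2 * B1 ^ 3 - 5 / 2 * B1 * B2 + B3) * (W $ 1) ^ 3"
      unfolding \<sigma>B \<mu>B by (simp add: M_def field_simps)
    finally show "inv_log_coeff f 3
        = - 1 / 24 * (B1 * (W $ 3 + \<sigma>2 * W $ 1 * W $ 2 + \<mu>2 * (W $ 1) ^ 3))"
      using c(2) by simp
  qed
  have bound: "norm (T22_inv f) \<le> 1 / 144 * A\<^sup>2 + M\<^sup>2 / 2304" if f: "f \<in> class_C \<phi>" for f
  proof -
    obtain \<omega> where \<omega>: "\<omega> holomorphic_on unit_disc" "\<omega> 0 = 0" "\<forall>z\<in>unit_disc. norm (\<omega> z) \<le> 1"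
      and eq: "\<forall>z\<in>unit_disc. 1 + z * deriv (deriv f) z / deriv f z = \<phi> (\<omega> z)"
      using f by (auto simp: class_C_def subordinate_def)
    define W where "W = fps_expansion \<omega> 0"
    have W: "\<omega> has_fps_expansion W"
      unfolding W_def by (rule has_fps_expansion_fps_expansion[OF open_ball _ \<omega>(1)]) simp
    note c = coeffs[OF f eq W \<omega>(2)]
    obtain x y :: complex where xy: "norm (W $ 1) \<le> 1" "norm x \<le> 1" "norm y \<le> 1"
      and W2: "W $ 2 = (1 - (norm (W $ 1))\<^sup>2) * x"
      and W3: "W $ 3 = (1 - (norm (W $ 1))\<^sup>2) * ((1 - (norm x)\<^sup>2) * y - cnj (W $ 1) * x\<^sup>2)"
      by (rule Schwarz_coeffs[OF \<omega> W])
    define t where "t = (norm (W $ 1))\<^sup>2"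
    have t: "0 \<le> t" "t \<le> 1" using xy(1) by (simp_all add: t_def power_le_one)
    have nt: "norm ((W $ 1)\<^sup>2) = t" by (simp add: t_def norm_power)
    have "norm (B1 * W $ 2 + A * (W $ 1)\<^sup>2) \<le> norm (B1 * W $ 2) + norm (A * (W $ 1)\<^sup>2)"
      by (rule norm_triangle_ineq)
    also have "\<dots> = B1 * (1 - t) * norm x + \<bar>A\<bar> * t"
      unfolding W2 t_def[symmetric] norm_mult nt using B1 t by (simp del: of_real_diff)
    also have "\<dots> \<le> B1 * (1 - t) * 1 + \<bar>A\<bar> * t"
      using B1 t xy(2) by (intro add_right_mono mult_left_mono) auto
    \<comment> \<open>The sum so far is a convex combination of \<open>B1\<close> and
      \<open>\<bar>A\<bar>\<close>, and \<open>B1\<close> is the smaller of the two by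
      assumption.\<close>
    also have "\<dots> \<le> \<bar>A\<bar> * (1 - t) + \<bar>A\<bar> * t"
      using assms(7) t mult_right_mono[of B1 "\<bar>A\<bar>" "1 - t"] by (simp add: A_def)
    finally have "norm (B1 * W $ 2 + A * (W $ 1)\<^sup>2) \<le> \<bar>A\<bar>" by (simp add: algebra_simps)
    then have c2: "norm (inv_log_coeff f 2) \<le> \<bar>A\<bar> / 12" unfolding c(1) by (simp add: norm_mult)
    have "norm (W $ 3 + \<sigma>2 * W $ 1 * W $ 2 + \<mu>2 * (W $ 1) ^ 3) \<le> \<mu>2"
      unfolding W2 W3 by (rule Prokhorov_Szynal[OF xy assms(8)])
    then have "B1 * norm (W $ 3 + \<sigma>2 * W $ 1 * W $ 2 + \<mu>2 * (W $ 1) ^ 3) \<le> M / 2"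
      using B1 \<mu>B by (metis mult_left_mono less_imp_le)
    then have c3: "norm (inv_log_coeff f 3) \<le> M / 48"
      unfolding c(2) using B1 by (simp add: norm_mult)
    have "norm (T22_inv f) \<le> (norm (inv_log_coeff f 2))\<^sup>2 + (norm (inv_log_coeff f 3))\<^sup>2"
      unfolding T22_inv_def norm_power[symmetric] by (rule norm_triangle_ineq4)
    \<comment> \<open>The constants 144 and 2304 are the squares of 12 and 48; 48 is twice 24
      because \<open>B1 * \<mu>2\<close> is half of \<open>M\<close>.\<close>
    also have "\<dots> \<le> (\<bar>A\<bar> / 12)\<^sup>2 + (M / 48)\<^sup>2"
      using c2 c3 by (intro add_mono power_mono) auto
    finally show ?thesis by (simp add: power_divide)
  qed
  \<comment> \<open>The choice \<open>\<omega> z = z\<close> would give the same moduli, but both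
    coefficients would be real and their squares would be subtracted. The factor \<open>\<i>\<close>
    keeps the second coefficient real and makes the third one imaginary.\<close>
  obtain f where f: "f \<in> class_C \<phi>"
    and eq: "\<forall>z\<in>unit_disc. 1 + z * deriv (deriv f) z / deriv f z = \<phi> (\<i> * z)"
    by (rule class_C_exists[OF \<phi>, of "\<lambda>z. \<i> * z"]) (auto intro!: holomorphic_intros simp: norm_mult)
  have "(\<lambda>z. \<i> * z) has_fps_expansion fps_const \<i> * fps_X"
    by (intro fps_expansion_intros)
  note c = coeffs[OF f eq this]
  have \<Gamma>2: "inv_log_coeff f 2 = A / 12" using c(1) by simp
  have \<Gamma>3: "inv_log_coeff f 3 = \<i> * complex_of_real (B1 * \<mu>2) / 24"
    using c(2) by (simp add: power3_eq_cube)
  have "T22_inv f = complex_of_real ((A / 12)\<^sup>2 + (B1 * \<mu>2 / 24)\<^sup>2)"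
    unfolding T22_inv_def \<Gamma>2 \<Gamma>3 by (simp add: power_mult_distrib power_divide)
  also have "(A / 12)\<^sup>2 + (B1 * \<mu>2 / 24)\<^sup>2 = 1 / 144 * A\<^sup>2 + M\<^sup>2 / 2304"
    unfolding \<mu>B by (simp add: power_divide)
  finally have "T22_inv f = complex_of_real (1 / 144 * A\<^sup>2 + M\<^sup>2 / 2304)" .
  moreover have "0 \<le> 1 / 144 * A\<^sup>2 + M\<^sup>2 / 2304" by simp
  ultimately have "norm (T22_inv f) = 1 / 144 * A\<^sup>2 + M\<^sup>2 / 2304"
    by (metis norm_of_real abs_of_nonneg)
  then show ?thesis using bound f unfolding A_def M_def by blast
qed

end
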